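(* Let $H=(\sigma,\alpha)$ be a connected orientable hypermap with dart set $D$, let $M(H)$ be its medial map with its canonical checkerboard coloring, and let $E'\subseteq E(H)$ be a set of hyperedges. The following are equivalent: (1) The partial dual $H^{E'}$ is Eulerian. (2) There exists a crossing-total direction $\Omega$ of $M(H)$ such that $E'=D(\Omega)\cup T'$ for some $T'\subseteq T(\Omega)$.
   Context: Permutations are composed from right to left. A connected orientable hypermap is a pair $H=(\sigma,\alpha)$ of permutations of a finite set $D=\{1,\dots,n\}$ of darts such that the group generated by $\sigma,\alpha$ acts transitively on $D$. Vertices are the cycles of $\sigma$ and hyperedges are the cycles of $\alpha$ (fixed points count as cycles of length 1); $E(H)$ is the set of hyperedges. $H$ is Eulerian if every cycle of its vertex permutation $\sigma$ has even length. Partial dual. For $E'\subseteq E(H)$, let $\alpha_{E'}$ be the product of the $\alpha$-cycles in $E'$ and $\alpha_{\overline{E'}}$ the product of the remaining $\alpha$-cycles. The partial dual is the hypermap $H^{E'}=(\sigma^{E'},\alpha^{E'})$ with vertex permutation $\sigma^{E'}=\alpha_{E'}^{-1}\sigma$ and hyperedge permutation $\alpha^{E'}=\alpha_{E'}^{-1}\alpha_{\overline{E'}}$. Medial map. Let $D^{\pm}=\{i^-,i^+: i\in D\}$ (the half-edges of $M(H)$). The medial map $M(H)=(\sigma_M,\alpha_M)$ has one vertex $v_e$ for each hyperedge $e=(i_1\,i_2\cdots i_k)$, with cyclic order of half-edges $(i_1^-\,i_1^+\,i_2^-\,i_2^+\cdots i_k^-\,i_k^+)$ (these are the cycles of $\sigma_M$),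 and one edge $m_i$ for each dart $i\in D$, with two ends $i^+$ and $\sigma(i)^-$ (so $\alpha_M=\prod_{i\in D}(i^+\,\sigma(i)^-)$). In the canonical checkerboard coloring of the faces of $M(H)$, the corners at $v_e$ are alternately black and white: the black corners are the pairs $(i_j^-,i_j^+)$ and the white corners are the pairs $(i_j^+,i_{j+1}^-)$, $1\le j\le k$, with $i_{k+1}:=i_1$. Directions. A direction (orientation) of $M(H)$ chooses for every edge one end as tail and the other as head; a half-edge at a vertex is directed out of the vertex if it is the tail and into the vertex if it is the head of its edge. A corner is a source/sink corner if its two half-edges are both directed into the vertex or both directed out of it; otherwise it is a crossing corner. A vertex $v$ is type-$t$ if all half-edges at $v$ are directed into $v$ or all are directed out of $v$; type-$c$ if it is not type-$t$ and every black corner at $v$ is a source/sink corner; type-$d$ if it is not type-$t$ and every white corner at $v$ is a source/sink corner. A crossing-total direction is a direction for which every vertex of $M(H)$ is of type $t$, $c$ or $d$. For such a direction $\Omega$, $D(\Omega)$ (resp. $T(\Omega)$) is the set of hyperedges $e$ of $H$ such that $v_e$ is type-$d$ (resp. type-$t$). *)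

theory Defs
  imports "HOL-Algebra.Sym_Groups" "HOL-Combinatorics.Orbits"
begin

section \<open>Hypermaps\<close>

text \<open>A hypermap is the pair of its vertex permutation and its (hyper)edge permutation. Cycles of a
  permutation are represented by their sets of elements, so the length of a cycle is its
  cardinality; fixed points give singletons. Permutations act on the whole type and are the identity
  outside the dart set. \<^term>\<open>inv'\<close> is the inverse function (as opposed to
  the inverse in a group).\<close>

type_synonym 'a hypermap = "('a \<Rightarrow> 'a) \<times> ('a \<Rightarrow> 'a)"

definition cycle_sets :: "'a set \<Rightarrow> ('a \<Rightarrow> 'a) \<Rightarrow> 'a set set" where
  "cycle_sets D p = orbit p ` D"

definition connected_hypermap :: "nat \<Rightarrow> nat hypermap \<Rightarrow> bool" where
  "connected_hypermap n = (\<lambda>(\<sigma>, \<alpha>).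
     \<sigma> permutes {1..n} \<and> \<alpha> permutes {1..n} \<and>
     (\<forall>x\<in>{1..n}. \<forall>y\<in>{1..n}. \<exists>g\<in>generate (sym_group n) {\<sigma>, \<alpha>}. g x = y))"

definition hyperedges :: "'a set \<Rightarrow> 'a hypermap \<Rightarrow> 'a set set" where
  "hyperedges D H = cycle_sets D (snd H)"

definition vertices :: "'a set \<Rightarrow> 'a hypermap \<Rightarrow> 'a set set" where
  "vertices D H = cycle_sets D (fst H)"

definition eulerian :: "'a set \<Rightarrow> 'a hypermap \<Rightarrow> bool" where
  "eulerian D H \<longleftrightarrow> (\<forall>v\<in>vertices D H. even (card v))"

text \<open>The product of a set of (disjoint) cycles of a permutation agrees with the permutation on the
  union of these cycles and fixes every other point.\<close>

definition cycle_product :: "('a \<Rightarrow> 'a) \<Rightarrow> 'a set set \<Rightarrow> ('a \<Rightarrow> 'a)" where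
  "cycle_product p C = perm_restrict p (\<Union>C)"

definition partial_dual :: "'a set \<Rightarrow> 'a hypermap \<Rightarrow> 'a set set \<Rightarrow> 'a hypermap" where
  "partial_dual D H E' =
     (inv' (cycle_product (snd H) E') \<circ> fst H,
      inv' (cycle_product (snd H) E') \<circ> cycle_product (snd H) (hyperedges D H - E'))"


section \<open>The medial map\<close>

datatype 'a half_edge = Minus 'a | Plus 'a

definition half_edges :: "'a set \<Rightarrow> 'a half_edge set" where
  "half_edges D = Minus ` D \<union> Plus ` D"

definition medial_vertex_perm :: "'a set \<Rightarrow> 'a hypermap \<Rightarrow> 'a half_edge \<Rightarrow> 'a half_edge" where
  "medial_vertex_perm D H = perm_restrict
     (\<lambda>h. case h of Minus i \<Rightarrow> Plus i | Plus i \<Rightarrow> Minus (snd H i)) (half_edges D)"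

definition medial_edge_perm :: "'a set \<Rightarrow> 'a hypermap \<Rightarrow> 'a half_edge \<Rightarrow> 'a half_edge" where
  "medial_edge_perm D H = perm_restrict
     (\<lambda>h. case h of Plus i \<Rightarrow> Minus (fst H i) | Minus j \<Rightarrow> Plus (inv' (fst H) j)) (half_edges D)"

definition medial_map :: "'a set \<Rightarrow> 'a hypermap \<Rightarrow> 'a half_edge hypermap" where
  "medial_map D H = (medial_vertex_perm D H, medial_edge_perm D H)"

definition medial_vertex :: "'a set \<Rightarrow> 'a half_edge set" where
  "medial_vertex e = Minus ` e \<union> Plus ` e"

text \<open>Black and white corners at a vertex of the medial map, as pairs of cyclically consecutive
  half-edges. At \<^term>\<open>medial_vertex e\<close> with \<^term>\<open>e\<close> of size one,
  these are one black corner \<open>(i\<^sup>-, i\<^sup>+)\<close> and one white corner \<open>(i\<^sup>+, i\<^sup>-)\<close>.\<close>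

definition black_corners :: "'a half_edge set \<Rightarrow> ('a half_edge \<times> 'a half_edge) set" where
  "black_corners v = {(Minus i, Plus i) | i. Minus i \<in> v}"

definition white_corners ::
    "'a hypermap \<Rightarrow> 'a half_edge set \<Rightarrow> ('a half_edge \<times> 'a half_edge) set" where
  "white_corners H v = {(Plus i, Minus (snd H i)) | i. Plus i \<in> v}"

text \<open>Faithfulness checks: the vertices and edges of the medial map are as described.\<close>

lemma orbit_medial_vertex_perm:
  assumes "finite D" "snd H permutes D" "i \<in> D"
  shows "orbit (medial_vertex_perm D H) (Minus i) = medial_vertex (orbit (snd H) i)"
    and "orbit (medial_vertex_perm D H) (Plus i) = medial_vertex (orbit (snd H) i)"
proof -
  let ?s = "medial_vertex_perm D H" and ?a = "snd H"
  have perm: "permutation ?a"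
    using assms by (auto simp: permutation_permutes)
  have self: "i \<in> orbit ?a i"
    by (rule permutation_self_in_orbit[OF perm])
  have sub: "j \<in> D" if "j \<in> orbit ?a i" for j
    using that by induction (use assms in \<open>auto simp: permutes_in_image\<close>)
  have sM: "?s (Minus j) = Plus j" and sP: "?s (Plus j) = Minus (?a j)" if "j \<in> D" for j
    using that by (auto simp: medial_vertex_perm_def perm_restrict_def half_edges_def)
  have step: "?s h \<in> medial_vertex (orbit ?a i)" if "h \<in> medial_vertex (orbit ?a i)" for h
    using that by (auto simp: medial_vertex_def sM sP sub intro: orbit.step)
  have start: "Minus i \<in> medial_vertex (orbit ?a i)" "Plus i \<in> medial_vertex (orbit ?a i)"
    using self by (auto simp: medial_vertex_def)
  have le: "orbit ?s h \<subseteq> medial_vertex (orbit ?a i)" if "h \<in> medial_vertex (orbit ?a i)" for h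
  proof
    fix k assume "k \<in> orbit ?s h"
    then show "k \<in> medial_vertex (orbit ?a i)"
      by induction (use that step in auto)
  qed
  have ge: "medial_vertex (orbit ?a i) \<subseteq> orbit ?s h" if "Minus (?a i) \<in> orbit ?s h" for h
  proof -
    have "Minus j \<in> orbit ?s h \<and> Plus j \<in> orbit ?s h" if "j \<in> orbit ?a i" for j
      using that
    proof induction
      case base
      have "?a i \<in> D" using assms by (simp add: permutes_in_image)
      with \<open>Minus (?a i) \<in> orbit ?s h\<close> show ?case by (metis orbit.step sM)
    next
      case (step j)
      have "j \<in> D" "?a j \<in> D" using sub step by (auto intro: orbit.step)
      with step show ?case by (metis orbit.step sM sP)
    qed
    then show ?thesis by (auto simp: medial_vertex_def)
  qed
  have P: "Minus (?a i) \<in> orbit ?s (Plus i)"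
    using orbit.base[of ?s "Plus i"] assms by (simp add: sP)
  have M: "Minus (?a i) \<in> orbit ?s (Minus i)"
    using orbit.step[OF orbit.base[of ?s "Minus i"]] assms by (simp add: sM sP)
  show "orbit ?s (Minus i) = medial_vertex (orbit ?a i)"
    using le[OF start(1)] ge[OF M] by blast
  show "orbit ?s (Plus i) = medial_vertex (orbit ?a i)"
    using le[OF start(2)] ge[OF P] by blast
qed

lemma vertices_medial_map:
  assumes "finite D" "snd H permutes D"
  shows "vertices (half_edges D) (medial_map D H) = medial_vertex ` hyperedges D H"
  using orbit_medial_vertex_perm[OF assms]
  by (auto simp: vertices_def hyperedges_def cycle_sets_def medial_map_def half_edges_def
      image_Un image_image)

lemma edges_medial_map:
  assumes "fst H permutes D"
  shows "hyperedges (half_edges D) (medial_map D H) = (\<lambda>i. {Plus i, Minus (fst H i)}) ` D"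
proof -
  let ?m = "medial_edge_perm D H" and ?s = "fst H"
  have mP: "?m (Plus i) = Minus (?s i)" and mM: "?m (Minus (?s i)) = Plus i" if "i \<in> D" for i
    using that assms permutes_in_image[OF assms]
    by (auto simp: medial_edge_perm_def perm_restrict_def half_edges_def permutes_inverses)
  have two: "orbit f x = {x, f x}" if "f (f x) = x" for f :: "'a half_edge \<Rightarrow> 'a half_edge" and x
  proof
    show "orbit f x \<subseteq> {x, f x}"
    proof
      fix y assume "y \<in> orbit f x"
      then show "y \<in> {x, f x}" by induction (use that in auto)
    qed
    show "{x, f x} \<subseteq> orbit f x"
      using orbit.base[of f x] orbit.step[OF orbit.base[of f x]] that by auto
  qed
  have oP: "orbit ?m (Plus i) = {Plus i, Minus (?s i)}" if "i \<in> D" for i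
    using two[of ?m "Plus i"] mP[OF that] mM[OF that] by simp
  have oM: "orbit ?m (Minus (?s i)) = {Plus i, Minus (?s i)}" if "i \<in> D" for i
    using two[of ?m "Minus (?s i)"] mP[OF that] mM[OF that] by auto
  have "Minus ` D = (\<lambda>i. Minus (?s i)) ` D"
    using permutes_image[OF assms] by (metis image_image)
  then show ?thesis
    using oP oM
    by (simp add: hyperedges_def cycle_sets_def medial_map_def half_edges_def image_Un image_image)
qed


section \<open>Directions of the medial map\<close>

text \<open>A direction is represented by its set of tails: half-edges in \<^term>\<open>\<Omega>\<close> are directed out of
  their vertex, all other half-edges into it.\<close>

definition direction :: "'a set \<Rightarrow> 'a hypermap \<Rightarrow> 'a half_edge set \<Rightarrow> bool" where
  "direction D H \<Omega> \<longleftrightarrow> \<Omega> \<subseteq> half_edges D \<and>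
     (\<forall>m\<in>hyperedges (half_edges D) (medial_map D H). \<exists>!h. h \<in> m \<and> h \<in> \<Omega>)"

definition source_sink_corner ::
    "'a half_edge set \<Rightarrow> 'a half_edge \<times> 'a half_edge \<Rightarrow> bool" where
  "source_sink_corner \<Omega> = (\<lambda>(h, h'). (h \<in> \<Omega> \<and> h' \<in> \<Omega>) \<or> (h \<notin> \<Omega> \<and> h' \<notin> \<Omega>))"

definition type_t :: "'a half_edge set \<Rightarrow> 'a half_edge set \<Rightarrow> bool" where
  "type_t \<Omega> v \<longleftrightarrow> (\<forall>h\<in>v. h \<notin> \<Omega>) \<or> (\<forall>h\<in>v. h \<in> \<Omega>)"

definition type_c :: "'a half_edge set \<Rightarrow> 'a half_edge set \<Rightarrow> bool" where
  "type_c \<Omega> v \<longleftrightarrow> \<not> type_t \<Omega> v \<and> (\<forall>c\<in>black_corners v. source_sink_corner \<Omega> c)"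

definition type_d :: "'a hypermap \<Rightarrow> 'a half_edge set \<Rightarrow> 'a half_edge set \<Rightarrow> bool" where
  "type_d H \<Omega> v \<longleftrightarrow> \<not> type_t \<Omega> v \<and> (\<forall>c\<in>white_corners H v. source_sink_corner \<Omega> c)"

definition crossing_total :: "'a set \<Rightarrow> 'a hypermap \<Rightarrow> 'a half_edge set \<Rightarrow> bool" where
  "crossing_total D H \<Omega> \<longleftrightarrow> direction D H \<Omega> \<and>
     (\<forall>v\<in>vertices (half_edges D) (medial_map D H).
        type_t \<Omega> v \<or> type_c \<Omega> v \<or> type_d H \<Omega> v)"

definition D_edges :: "'a set \<Rightarrow> 'a hypermap \<Rightarrow> 'a half_edge set \<Rightarrow> 'a set set" where
  "D_edges D H \<Omega> = {e \<in> hyperedges D H. type_d H \<Omega> (medial_vertex e)}"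

definition T_edges :: "'a set \<Rightarrow> 'a hypermap \<Rightarrow> 'a half_edge set \<Rightarrow> 'a set set" where
  "T_edges D H \<Omega> = {e \<in> hyperedges D H. type_t \<Omega> (medial_vertex e)}"

end

theory Submission
  imports Defs
begin

text \<open>Both sides of the equivalence say that the darts admit a certain 2-colouring.

  All cycles of a permutation are even if and only if its points can be coloured with two colours so
  that the permutation always changes the colour (\<open>even_cycles_iff_alternating\<close>). Hence,
  with \<open>\<beta>\<close> the product of the cycles in \<open>E'\<close>, the partial dual is Eulerian
  if and only if some \<open>f\<close> satisfies \<open>f (\<beta>\<^sup>-\<^sup>1 (\<sigma> i)) \<noteq> f i\<close> for all darts \<open>i\<close>.

  A direction of the medial map is determined by the colouring \<open>f\<close> that tells whether
  \<open>i\<^sup>+\<close> is a tail; the edge from \<open>i\<^sup>+\<close> to \<open>\<sigma>(i)\<^sup>-\<close> then forces the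
  opposite value on \<open>\<sigma>(i)\<^sup>-\<close>. At a hyperedge, a direction is of type \<open>t\<close> exactly if
  both its black and its white corners are source/sink corners, because the corners link the
  half-edges at the vertex in a cycle. So the direction is crossing-total
  with \<open>D(\<Omega>) \<subseteq> E' \<subseteq> D(\<Omega>) \<union> T(\<Omega>)\<close>
  exactly if all white corners at hyperedges in \<open>E'\<close> and all black corners at the other
  hyperedges are source/sink corners (\<open>crossing_total_iff_corners\<close>). The white corner at
  \<open>i\<^sup>+\<close> leads to \<open>\<alpha>(i)\<^sup>-\<close> and the black one to \<open>i\<^sup>-\<close>, so in both
  cases the corner selected by \<open>E'\<close> leads from \<open>i\<^sup>+\<close> to \<open>\<beta>(i)\<^sup>-\<close>, and the
  condition is that these two half-edges are always directed alike
  (\<open>crossing_total_iff_cycle_product\<close>). Combined with the edges of the medial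
  map, this is \<open>f (\<beta>\<^sup>-\<^sup>1 (\<sigma> i)) \<noteq> f i\<close> again.\<close>

section \<open>Permutations with even cycles\<close>

lemma funpow_fixes_iff_card_orbit_dvd:
  assumes "permutation p"
  shows "(p ^^ n) x = x \<longleftrightarrow> card (orbit p x) dvd n"
proof -
  let ?N = "funpow_dist1 p x x"
  have self: "x \<in> orbit p x"
    using assms by (rule permutation_self_in_orbit)
  have "card (orbit p x) = card ((\<lambda>n. (p ^^ n) x) ` {0..<?N})"
    using orbit_conv_funpow_dist1[OF self] by simp
  also have "\<dots> = ?N"
    using card_image[OF inj_on_funpow_dist1[OF self]] by simp
  finally have card: "card (orbit p x) = ?N" .
  have "(p ^^ ?N) x = x"
    using self by (rule funpow_dist1_prop)
  then have mod: "(p ^^ n) x = (p ^^ (n mod ?N)) x"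
    by (simp add: funpow_mod_eq)
  show ?thesis
  proof
    assume "(p ^^ n) x = x"
    moreover have "n mod ?N < ?N" by simp
    ultimately have "n mod ?N = 0"
      using mod funpow_dist1_least[of "n mod ?N" p x x] by (metis gr0I)
    then show "card (orbit p x) dvd n"
      unfolding card by auto
  next
    assume "card (orbit p x) dvd n"
    then have "n mod ?N = 0" unfolding card by simp
    then show "(p ^^ n) x = x" using mod by simp
  qed
qed

lemma funpow_eq_imp_same_parity:
  assumes p: "permutation p" and even: "even (card (orbit p x))"
    and eq: "(p ^^ a) x = (p ^^ b) x"
  shows "even a \<longleftrightarrow> even b"
proof -
  have *: "even c \<longleftrightarrow> even d" if "c \<le> d" "(p ^^ c) x = (p ^^ d) x" for c d
  proof -
    have "inj (p ^^ c)"
      using p by (simp add: permutation_bijective bij_is_inj inj_fn)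
    moreover have "(p ^^ c) ((p ^^ (d - c)) x) = (p ^^ c) x"
      using that by (metis comp_apply funpow_add le_add_diff_inverse)
    ultimately have "(p ^^ (d - c)) x = x"
      by (rule injD)
    then have "card (orbit p x) dvd d - c"
      using funpow_fixes_iff_card_orbit_dvd[OF p] by blast
    then have "even (d - c)"
      using even dvd_trans by blast
    then show ?thesis
      using that(1) by auto
  qed
  show ?thesis
    using *[OF _ eq] *[OF _ eq[symmetric]] nat_le_linear[of a b] by blast
qed

text \<open>Around an alternating cycle the colour returns to its initial value, so the length is even.
  Conversely, the colour of a point can be the parity of its distance from a base point
  of its cycle: on an even cycle this parity does not depend on the number of turns.\<close>

lemma even_cycles_iff_alternating:
  assumes "finite D" and D: "p permutes D"
  shows "(\<forall>c\<in>cycle_sets D p. even (card c)) \<longleftrightarrow> (\<exists>f. \<forall>x\<in>D. f (p x) = (\<not> f x))"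
proof -
  have p: "permutation p"
    using assms by (auto simp: permutation_permutes)
  show ?thesis
  proof
    assume even: "\<forall>c\<in>cycle_sets D p. even (card c)"
    define base where "base x = (SOME y. y \<in> orbit p x)" for x
    define dist where "dist x = funpow_dist p (base x) x" for x
    have base: "base x \<in> orbit p x" for x
      unfolding base_def using permutation_self_in_orbit[OF p] by (rule someI)
    have dist: "(p ^^ dist x) (base x) = x" for x
      unfolding dist_def
      by (rule funpow_dist_prop) (rule orbit_swap[OF permutation_self_in_orbit[OF p] base])
    have "even (dist (p x)) = (\<not> even (dist x))" if "x \<in> D" for x
    proof -
      have "base x \<in> D"
        using permutes_orbit_subset[OF D that] base by blast
      then have "even (card (orbit p (base x)))"
        using even by (auto simp: cycle_sets_def)
      moreover have "base (p x) = base x"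
        unfolding base_def permutation_orbit_step[OF p] ..
      then have "(p ^^ dist (p x)) (base x) = (p ^^ Suc (dist x)) (base x)"
        using dist[of x] dist[of "p x"] by simp
      ultimately show ?thesis
        using funpow_eq_imp_same_parity[OF p] even_Suc by blast
    qed
    then show "\<exists>f. \<forall>x\<in>D. f (p x) = (\<not> f x)"
      by (intro exI[of _ "\<lambda>x. even (dist x)"]) simp
  next
    assume "\<exists>f. \<forall>x\<in>D. f (p x) = (\<not> f x)"
    then obtain f where f: "f (p x) = (\<not> f x)" if "x \<in> D" for x
      by blast
    have "even (card (orbit p x))" if x: "x \<in> D" for x
    proof -
      have "(p ^^ k) x \<in> D \<and> f ((p ^^ k) x) = (f x = even k)" for k
        using x f permutes_in_image[OF D] by (induction k) auto
      then have "f ((p ^^ card (orbit p x)) x) = (f x = even (card (orbit p x)))"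
        by blast
      moreover have "(p ^^ card (orbit p x)) x = x"
        unfolding funpow_fixes_iff_card_orbit_dvd[OF p] by (rule dvd_refl)
      ultimately have "f x = (f x = even (card (orbit p x)))"
        by (rule subst[rotated])
      then show ?thesis
        by blast
    qed
    then show "\<forall>c\<in>cycle_sets D p. even (card c)"
      by (auto simp: cycle_sets_def)
  qed
qed

section \<open>Cycles of the hyperedge permutation\<close>

lemma cycle_sets_cyclic_on:
  assumes "finite D" "p permutes D" "c \<in> cycle_sets D p"
  shows "cyclic_on p c"
proof -
  obtain x where "c = orbit p x"
    using assms(3) by (auto simp: cycle_sets_def)
  then show ?thesis
    using cyclic_on_orbit[OF assms(2,1)] by simp
qed

lemma cycle_sets_subset:
  assumes "p permutes D" "c \<in> cycle_sets D p"
  shows "c \<subseteq> D"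
proof -
  obtain x where "x \<in> D" "c = orbit p x"
    using assms(2) by (auto simp: cycle_sets_def)
  then show ?thesis
    using permutes_orbit_subset[OF assms(1)] by simp
qed

lemma Union_cycle_sets:
  assumes "finite D" "p permutes D"
  shows "\<Union>(cycle_sets D p) = D"
proof -
  have "x \<in> orbit p x" for x
    using assms by (intro permutation_self_in_orbit) (auto simp: permutation_permutes)
  then have "D \<subseteq> \<Union>(cycle_sets D p)"
    by (auto simp: cycle_sets_def)
  moreover have "\<Union>(cycle_sets D p) \<subseteq> D"
    using cycle_sets_subset[OF assms(2)] by (rule Union_least)
  ultimately show ?thesis
    by (rule equalityI[rotated])
qed

lemma mem_Union_cycles_iff:
  assumes "finite D" "p permutes D" "C \<subseteq> cycle_sets D p" "c \<in> cycle_sets D p" "x \<in> c"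
  shows "x \<in> \<Union>C \<longleftrightarrow> c \<in> C"
proof
  assume "x \<in> \<Union>C"
  then obtain c' where "c' \<in> C" "x \<in> c'"
    by blast
  then have "orbit p x = c'"
    using assms(3) by (intro orbit_cyclic_eq3 cycle_sets_cyclic_on[OF assms(1,2)]) auto
  moreover have "orbit p x = c"
    using assms(4,5) by (intro orbit_cyclic_eq3 cycle_sets_cyclic_on[OF assms(1,2)])
  ultimately have "c' = c"
    by simp
  with \<open>c' \<in> C\<close> show "c \<in> C"
    by simp
qed (use assms in blast)

lemma cycle_product_permutes:
  assumes "finite D" and p: "p permutes D" and C: "C \<subseteq> cycle_sets D p"
  shows "cycle_product p C permutes D"
proof -
  have "c \<in> C \<Longrightarrow> cyclic_on p c" for c
    using assms cycle_sets_cyclic_on by blast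
  then have stable: "p x \<in> \<Union>C" if "x \<in> \<Union>C" for x
    using that cyclic_on_inI by fastforce
  have sub: "\<Union>C \<subseteq> D"
    using C cycle_sets_subset[OF p] by blast
  have inj: "inj_on p (\<Union>C)"
    using permutes_inj[OF p] inj_on_subset by blast
  have "finite (\<Union>C)"
    using sub \<open>finite D\<close> finite_subset by blast
  then have "p ` \<Union>C = \<Union>C"
    using stable inj by (intro endo_inj_surj) auto
  then have "bij_betw (perm_restrict p (\<Union>C)) (\<Union>C) (\<Union>C)"
    using inj by (simp add: bij_betw_def perm_restrict_simps inj_on_def)
  then have "perm_restrict p (\<Union>C) permutes \<Union>C"
    by (rule bij_imp_permutes) (simp add: perm_restrict_simps)
  then show ?thesis
    unfolding cycle_product_def using sub by (rule permutes_subset)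
qed

section \<open>Directions of the medial map\<close>

lemma direction_iff:
  assumes "fst H permutes D"
  shows "direction D H \<Omega> \<longleftrightarrow> \<Omega> \<subseteq> half_edges D \<and>
    (\<forall>i\<in>D. Plus i \<in> \<Omega> \<longleftrightarrow> Minus (fst H i) \<notin> \<Omega>)"
  unfolding direction_def edges_medial_map[OF assms] by auto

lemma black_corners_source_sink_iff:
  "(\<forall>c\<in>black_corners (medial_vertex e). source_sink_corner \<Omega> c) \<longleftrightarrow>
   (\<forall>i\<in>e. Plus i \<in> \<Omega> \<longleftrightarrow> Minus i \<in> \<Omega>)"
proof -
  have "black_corners (medial_vertex e) = (\<lambda>i. (Minus i, Plus i)) ` e"
    by (auto simp: black_corners_def medial_vertex_def)
  then show ?thesis
    by (auto simp: source_sink_corner_def)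
qed

lemma white_corners_source_sink_iff:
  "(\<forall>c\<in>white_corners H (medial_vertex e). source_sink_corner \<Omega> c) \<longleftrightarrow>
   (\<forall>i\<in>e. Plus i \<in> \<Omega> \<longleftrightarrow> Minus (snd H i) \<in> \<Omega>)"
proof -
  have "white_corners H (medial_vertex e) = (\<lambda>i. (Plus i, Minus (snd H i))) ` e"
    by (auto simp: white_corners_def medial_vertex_def)
  then show ?thesis
    by (auto simp: source_sink_corner_def)
qed

text \<open>Black corners link \<open>i\<^sup>-\<close> to \<open>i\<^sup>+\<close> and white corners link
  \<open>i\<^sup>+\<close> to \<open>\<alpha>(i)\<^sup>-\<close>, so together they carry one direction all around the vertex.\<close>

lemma type_t_iff_all_corners:
  assumes cyc: "cyclic_on (snd H) e"
  shows "type_t \<Omega> (medial_vertex e) \<longleftrightarrow>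
    (\<forall>c\<in>black_corners (medial_vertex e). source_sink_corner \<Omega> c) \<and>
    (\<forall>c\<in>white_corners H (medial_vertex e). source_sink_corner \<Omega> c)"
  unfolding black_corners_source_sink_iff white_corners_source_sink_iff
proof
  assume "type_t \<Omega> (medial_vertex e)"
  then show "(\<forall>i\<in>e. (Plus i \<in> \<Omega>) = (Minus i \<in> \<Omega>)) \<and>
      (\<forall>i\<in>e. (Plus i \<in> \<Omega>) = (Minus (snd H i) \<in> \<Omega>))"
    using cyclic_on_inI[OF cyc] by (auto simp: type_t_def medial_vertex_def)
next
  assume ss: "(\<forall>i\<in>e. (Plus i \<in> \<Omega>) = (Minus i \<in> \<Omega>)) \<and>
      (\<forall>i\<in>e. (Plus i \<in> \<Omega>) = (Minus (snd H i) \<in> \<Omega>))"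
  obtain x where x: "x \<in> e" and e: "e = orbit (snd H) x"
    using cyc unfolding cyclic_on_def by blast
  have "j \<in> e \<and> (Minus j \<in> \<Omega> \<longleftrightarrow> Minus x \<in> \<Omega>)" if "j \<in> orbit (snd H) x" for j
    using that
  proof induction
    case base
    then show ?case using ss x cyclic_on_inI[OF cyc x] by blast
  next
    case (step j)
    then show ?case using ss cyclic_on_inI[OF cyc, of j] by blast
  qed
  then have "\<forall>j\<in>e. (Minus j \<in> \<Omega> \<longleftrightarrow> Minus x \<in> \<Omega>) \<and> (Plus j \<in> \<Omega> \<longleftrightarrow> Minus x \<in> \<Omega>)"
    using ss e by blast
  then show "type_t \<Omega> (medial_vertex e)"
    by (auto simp: type_t_def medial_vertex_def)
qed

text \<open>A hyperedge of type \<open>t\<close> meets both corner conditions, so it may lie in \<open>E'\<close>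
  or not; this is the freedom in choosing \<open>T'\<close>.\<close>

lemma crossing_total_iff_corners:
  assumes "finite D" and \<alpha>: "snd H permutes D" and E': "E' \<subseteq> hyperedges D H"
  shows "crossing_total D H \<Omega> \<and> (\<exists>T' \<subseteq> T_edges D H \<Omega>. E' = D_edges D H \<Omega> \<union> T') \<longleftrightarrow>
    direction D H \<Omega> \<and> (\<forall>e\<in>hyperedges D H. \<forall>c\<in>
      (if e \<in> E' then white_corners H (medial_vertex e) else black_corners (medial_vertex e)).
        source_sink_corner \<Omega> c)"
    (is "_ \<longleftrightarrow> _ \<and> ?corners")
proof -
  define B where "B e \<longleftrightarrow> (\<forall>c\<in>black_corners (medial_vertex e). source_sink_corner \<Omega> c)" for e
  define W where "W e \<longleftrightarrow> (\<forall>c\<in>white_corners H (medial_vertex e). source_sink_corner \<Omega> c)" for e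
  have t: "type_t \<Omega> (medial_vertex e) \<longleftrightarrow> B e \<and> W e" if "e \<in> hyperedges D H" for e
    using that type_t_iff_all_corners cycle_sets_cyclic_on[OF assms(1,2)]
    unfolding hyperedges_def B_def W_def by blast
  have c: "type_c \<Omega> (medial_vertex e) \<longleftrightarrow> B e \<and> \<not> W e" if "e \<in> hyperedges D H" for e
    using t[OF that] unfolding type_c_def B_def[symmetric] by blast
  have d: "type_d H \<Omega> (medial_vertex e) \<longleftrightarrow> W e \<and> \<not> B e" if "e \<in> hyperedges D H" for e
    using t[OF that] unfolding type_d_def W_def[symmetric] by blast
  have "(\<forall>e\<in>hyperedges D H. type_t \<Omega> (medial_vertex e) \<or> type_c \<Omega> (medial_vertex e) \<or>
      type_d H \<Omega> (medial_vertex e)) \<longleftrightarrow> (\<forall>e\<in>hyperedges D H. B e \<or> W e)"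
    by (intro ball_cong refl) (use t c d in blast)
  then have total: "crossing_total D H \<Omega> \<longleftrightarrow>
      direction D H \<Omega> \<and> (\<forall>e\<in>hyperedges D H. B e \<or> W e)"
    unfolding crossing_total_def vertices_medial_map[OF assms(1,2)] by simp
  have D: "D_edges D H \<Omega> = {e \<in> hyperedges D H. W e \<and> \<not> B e}"
    unfolding D_edges_def using d by blast
  have T: "T_edges D H \<Omega> = {e \<in> hyperedges D H. W e \<and> B e}"
    unfolding T_edges_def using t by blast
  have corners: "?corners \<longleftrightarrow> (\<forall>e\<in>hyperedges D H. (e \<in> E' \<longrightarrow> W e) \<and> (e \<notin> E' \<longrightarrow> B e))"
    unfolding B_def W_def by simp
  have union: "(\<exists>T' \<subseteq> T_edges D H \<Omega>. E' = D_edges D H \<Omega> \<union> T') \<longleftrightarrow>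
      D_edges D H \<Omega> \<subseteq> E' \<and> E' \<subseteq> D_edges D H \<Omega> \<union> T_edges D H \<Omega>"
    by (auto intro!: exI[of _ "E' - D_edges D H \<Omega>"])
  show ?thesis
    unfolding total corners union unfolding D T using E' by blast
qed

text \<open>The product of the cycles in \<open>E'\<close> acts as \<open>\<alpha>\<close> on a hyperedge in \<open>E'\<close>, as
  the white corners do, and trivially on any other hyperedge, as the black corners do.\<close>

lemma crossing_total_iff_cycle_product:
  assumes "finite D" and \<alpha>: "snd H permutes D" and E': "E' \<subseteq> hyperedges D H"
  shows "crossing_total D H \<Omega> \<and> (\<exists>T' \<subseteq> T_edges D H \<Omega>. E' = D_edges D H \<Omega> \<union> T') \<longleftrightarrow>
    direction D H \<Omega> \<and>
    (\<forall>i\<in>D. Plus i \<in> \<Omega> \<longleftrightarrow> Minus (cycle_product (snd H) E' i) \<in> \<Omega>)"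
proof -
  have \<beta>: "cycle_product (snd H) E' i = (if e \<in> E' then snd H i else i)"
    if "e \<in> hyperedges D H" "i \<in> e" for e i
    using mem_Union_cycles_iff[OF assms(1,2)] E' that
    by (simp add: cycle_product_def perm_restrict_def hyperedges_def)
  have "(\<forall>e\<in>hyperedges D H. \<forall>c\<in>
      (if e \<in> E' then white_corners H (medial_vertex e) else black_corners (medial_vertex e)).
        source_sink_corner \<Omega> c) \<longleftrightarrow>
    (\<forall>e\<in>hyperedges D H. \<forall>i\<in>e. Plus i \<in> \<Omega> \<longleftrightarrow> Minus (cycle_product (snd H) E' i) \<in> \<Omega>)"
    by (intro ball_cong refl)
      (simp add: \<beta> black_corners_source_sink_iff white_corners_source_sink_iff)
  also have "\<dots> \<longleftrightarrow>
      (\<forall>i\<in>\<Union>(hyperedges D H). Plus i \<in> \<Omega> \<longleftrightarrow> Minus (cycle_product (snd H) E' i) \<in> \<Omega>)"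
    by blast
  also have "\<Union>(hyperedges D H) = D"
    unfolding hyperedges_def using assms(1,2) by (rule Union_cycle_sets)
  finally show ?thesis
    unfolding crossing_total_iff_corners[OF assms] by simp
qed

section \<open>Eulerian partial duals\<close>

lemma eulerian_partial_dual_iff_alternating:
  assumes "finite D" "fst H permutes D" "snd H permutes D" "E' \<subseteq> hyperedges D H"
  shows "eulerian D (partial_dual D H E') \<longleftrightarrow>
    (\<exists>f. \<forall>i\<in>D. f (inv' (cycle_product (snd H) E') (fst H i)) = (\<not> f i))"
proof -
  have "cycle_product (snd H) E' permutes D"
    using assms by (intro cycle_product_permutes) (simp_all add: hyperedges_def)
  then have "inv' (cycle_product (snd H) E') \<circ> fst H permutes D"
    using assms(2) by (intro permutes_compose permutes_inv)
  from even_cycles_iff_alternating[OF assms(1) this] show ?thesis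
    unfolding eulerian_def vertices_def partial_dual_def fst_conv comp_apply .
qed

lemma eulerian_partial_dual_iff_crossing_total:
  assumes fin: "finite D" and \<sigma>: "fst H permutes D" and \<alpha>: "snd H permutes D"
    and E': "E' \<subseteq> hyperedges D H"
  shows "eulerian D (partial_dual D H E') \<longleftrightarrow>
    (\<exists>\<Omega>. crossing_total D H \<Omega> \<and> (\<exists>T' \<subseteq> T_edges D H \<Omega>. E' = D_edges D H \<Omega> \<union> T'))"
proof -
  let ?\<sigma> = "fst H" and ?\<beta> = "cycle_product (snd H) E'"
  have \<beta>: "?\<beta> permutes D"
    using fin \<alpha> E' by (intro cycle_product_permutes) (simp_all add: hyperedges_def)
  have "(\<exists>f. \<forall>i\<in>D. f (inv' ?\<beta> (?\<sigma> i)) = (\<not> f i)) \<longleftrightarrow>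
    (\<exists>\<Omega>. direction D H \<Omega> \<and> (\<forall>i\<in>D. Plus i \<in> \<Omega> \<longleftrightarrow> Minus (?\<beta> i) \<in> \<Omega>))"
  proof
    assume "\<exists>f. \<forall>i\<in>D. f (inv' ?\<beta> (?\<sigma> i)) = (\<not> f i)"
    then obtain f where f: "\<forall>i\<in>D. f (inv' ?\<beta> (?\<sigma> i)) = (\<not> f i)" ..
    \<comment> \<open>The tails among the \<open>i\<^sup>+\<close> are free; the selected corner at
      \<open>\<beta>\<^sup>-\<^sup>1(j)\<^sup>+\<close> then decides about \<open>j\<^sup>-\<close>.\<close>
    define \<Omega> where "\<Omega> = {Plus i | i. i \<in> D \<and> f i} \<union> {Minus j | j. j \<in> D \<and> f (inv' ?\<beta> j)}"
    have sub: "\<Omega> \<subseteq> half_edges D"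
      by (auto simp: \<Omega>_def half_edges_def)
    have plus: "Plus i \<in> \<Omega> \<longleftrightarrow> i \<in> D \<and> f i"
      and minus: "Minus i \<in> \<Omega> \<longleftrightarrow> i \<in> D \<and> f (inv' ?\<beta> i)" for i
      by (simp_all add: \<Omega>_def)
    have "direction D H \<Omega>"
      unfolding direction_iff[OF \<sigma>] plus minus permutes_in_image[OF \<sigma>]
      using sub f by blast
    moreover have "\<forall>i\<in>D. Plus i \<in> \<Omega> \<longleftrightarrow> Minus (?\<beta> i) \<in> \<Omega>"
      unfolding plus minus permutes_in_image[OF \<beta>] permutes_inverses(2)[OF \<beta>] by simp
    ultimately show "\<exists>\<Omega>. direction D H \<Omega> \<and> (\<forall>i\<in>D. Plus i \<in> \<Omega> \<longleftrightarrow> Minus (?\<beta> i) \<in> \<Omega>)"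
      by blast
  next
    assume "\<exists>\<Omega>. direction D H \<Omega> \<and> (\<forall>i\<in>D. Plus i \<in> \<Omega> \<longleftrightarrow> Minus (?\<beta> i) \<in> \<Omega>)"
    then obtain \<Omega> where dir: "direction D H \<Omega>"
      and corner: "\<forall>i\<in>D. Plus i \<in> \<Omega> \<longleftrightarrow> Minus (?\<beta> i) \<in> \<Omega>"
      by blast
    have edge: "\<forall>i\<in>D. Plus i \<in> \<Omega> \<longleftrightarrow> Minus (?\<sigma> i) \<notin> \<Omega>"
      using dir unfolding direction_iff[OF \<sigma>] by (rule conjunct2)
    have "Plus (inv' ?\<beta> (?\<sigma> i)) \<in> \<Omega> \<longleftrightarrow> Plus i \<notin> \<Omega>" if "i \<in> D" for i
    proof -
      have "inv' ?\<beta> (?\<sigma> i) \<in> D"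
        using that unfolding permutes_in_image[OF permutes_inv[OF \<beta>]] permutes_in_image[OF \<sigma>] .
      from corner[rule_format, OF this]
      have "Plus (inv' ?\<beta> (?\<sigma> i)) \<in> \<Omega> \<longleftrightarrow> Minus (?\<sigma> i) \<in> \<Omega>"
        unfolding permutes_inverses(1)[OF \<beta>] .
      then show ?thesis
        using edge[rule_format, OF that] by blast
    qed
    then show "\<exists>f. \<forall>i\<in>D. f (inv' ?\<beta> (?\<sigma> i)) = (\<not> f i)"
      by (intro exI[of _ "\<lambda>i. Plus i \<in> \<Omega>"]) simp
  qed
  then show ?thesis
    unfolding eulerian_partial_dual_iff_alternating[OF assms]
      crossing_total_iff_cycle_product[OF fin \<alpha> E'] .
qed

theorem theorem5p3:
  fixes n :: nat and \<sigma> \<alpha> :: "nat \<Rightarrow> nat" and D :: "nat set" and H :: "nat hypermap"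
    and E' :: "nat set set"
  assumes "D = {1..n}" and "H = (\<sigma>, \<alpha>)"
    and "connected_hypermap n H"
    and "E' \<subseteq> hyperedges D H"
  shows "eulerian D (partial_dual D H E') \<longleftrightarrow>
    (\<exists>\<Omega>. crossing_total D H \<Omega> \<and> (\<exists>T' \<subseteq> T_edges D H \<Omega>. E' = D_edges D H \<Omega> \<union> T'))"
  using assms
  by (intro eulerian_partial_dual_iff_crossing_total) (auto simp: connected_hypermap_def)

end
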